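(* Let $m \geq 1$, $j \geq 2$ and $k \geq 1$ be integers and let $N = 2mj^k$. Then the set $\{1, 2, \ldots, N\}$ of the first $N$ consecutive positive integers can be separated, in at least $\{(j-1)!\}^{k-1}$ ways, into $j$ sets $A_1, \ldots, A_j$, each consisting of $2mj^{k-1}$ integers, such that $$\sum_{a \in A_1} a^r = \sum_{a \in A_2} a^r = \cdots = \sum_{a \in A_j} a^r \quad \text{for every } r = 1, 2, \ldots, k.$$
   Context: To separate $\{1,\ldots,N\}$ into $j$ sets means to partition it into $j$ pairwise disjoint sets whose union is $\{1,\ldots,N\}$. Different "ways" are different partitions, a partition being regarded as an unordered collection of $j$ sets (permuting the labels of $A_1,\ldots,A_j$ does not give a new way). *)

theory Defs
  imports "HOL-Library.Disjoint_Sets"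
begin

(* A way of separating {1..N} into j sets is an unordered collection P of j blocks, so permuting
   the labels A_1, ..., A_j does not give a new way. partition_on also requires the blocks to be
   nonempty, which for s >= 1 already follows from the block size. *)
definition equal_power_sum_separations :: "nat \<Rightarrow> nat \<Rightarrow> nat \<Rightarrow> nat \<Rightarrow> nat set set set" where
  "equal_power_sum_separations N j s k =
    {P. partition_on {1..N} P \<and> card P = j \<and> (\<forall>A\<in>P. card A = s) \<and>
        (\<forall>r\<in>{1..k}. \<forall>A\<in>P. \<forall>B\<in>P. (\<Sum>a\<in>A. a ^ r) = (\<Sum>b\<in>B. b ^ r))}"

end

theory Submission
  imports Defs "HOL-Combinatorics.Permutations"
begin

text \<open>
  The proof is an induction on \<open>k\<close> in which passing from \<open>k\<close> to \<open>k + 1\<close> multiplies the length of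
  the interval by \<open>j\<close>, raises the degree up to which the power sums agree by one, and multiplies
  the number of known separations by \<open>(j - 1)!\<close>.

  For \<open>k = 1\<close> and \<open>N = 2mj\<close>, the numbers \<open>x\<close> and \<open>N + 1 - x\<close> form \<open>mj\<close> pairs of equal sum, and
  each block receives \<open>m\<close> of these pairs (\<open>equal_sum_separation_exists\<close>).

  For the step, let \<open>P\<close> be a separation of \<open>{1..M}\<close> whose blocks have equal power sums of degree
  at most \<open>k\<close>. The interval \<open>{1..j * M}\<close> consists of \<open>j\<close> translates of \<open>{1..M}\<close>, and each
  translate carries a copy of \<open>P\<close>. A Latin square \<open>L\<close> with symbols in \<open>P\<close> glues these copies: the
  new block belonging to \<open>A\<close> consists of the sets \<open>L c A + c * M\<close> for \<open>c < j\<close>. Expand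
  \<open>(c * M + a) ^ r\<close> with \<open>r \<le> k + 1\<close> by the binomial theorem and sum over the new block. The terms
  in which the exponent of \<open>a\<close> is less than \<open>r\<close> do not depend on the block by the assumption on
  \<open>P\<close>. The terms \<open>a ^ r\<close> add up to the sum over all of \<open>{1..M}\<close>, because \<open>c \<mapsto> L c A\<close> runs
  through every block of \<open>P\<close> exactly once. So the power sums of the new blocks agree up to degree
  \<open>k + 1\<close> (\<open>glued_partition_is_separation\<close>).

  Normalise \<open>L\<close> by letting its row \<open>0\<close> be the identity. Then the new separation determines \<open>P\<close>, as
  its trace on \<open>{1..M}\<close>, and then \<open>L\<close>, from its traces on the other translates
  (\<open>glued_partition_eqD\<close>). Permuting the \<open>j - 1\<close> rows other than row \<open>0\<close> of the addition table
  modulo \<open>j\<close> gives \<open>(j - 1)!\<close> such squares, whence the factor in \<open>card_separations_step\<close>.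
\<close>

section \<open>Latin squares\<close>

definition latin_square_on :: "nat \<Rightarrow> 'a set \<Rightarrow> (nat \<Rightarrow> 'a \<Rightarrow> 'a) \<Rightarrow> bool" where
  "latin_square_on j P L \<longleftrightarrow>
     (\<forall>c<j. bij_betw (L c) P P) \<and> (\<forall>A\<in>P. bij_betw (\<lambda>c. L c A) {..<j} P)"

definition permuted_addition_table :: "nat \<Rightarrow> (nat \<Rightarrow> 'a) \<Rightarrow> (nat \<Rightarrow> nat) \<Rightarrow> nat \<Rightarrow> 'a \<Rightarrow> 'a" where
  "permuted_addition_table j h \<tau> c A = h ((inv_into {..<j} h A + \<tau> c) mod j)"

lemma bij_betw_add_mod:
  fixes t j :: nat
  assumes "j > 0"
  shows "bij_betw (\<lambda>i. (i + t) mod j) {..<j} {..<j}"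
proof -
  have le: "x = y" if "x \<le> y" "y < j" "(x + t) mod j = (y + t) mod j" for x y
  proof -
    have "(y + t) mod j = (x + t) mod j \<longleftrightarrow> j dvd (y + t) - (x + t)"
      using that by (intro mod_eq_dvd_iff_nat) auto
    then have "j dvd y - x" using that by simp
    then show ?thesis using that by (auto dest: dvd_imp_le)
  qed
  have "inj_on (\<lambda>i. (i + t) mod j) {..<j}"
  proof (rule inj_onI)
    fix x y assume "x \<in> {..<j}" "y \<in> {..<j}" "(x + t) mod j = (y + t) mod j"
    then show "x = y" using le[of x y] le[of y x] by (cases "x \<le> y") auto
  qed
  moreover have "(\<lambda>i. (i + t) mod j) ` {..<j} \<subseteq> {..<j}" using assms by auto
  ultimately show ?thesis
    by (simp add: bij_betw_def endo_inj_surj)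
qed

lemma latin_square_permuted_addition_table:
  assumes j: "j > 0" and h: "bij_betw h {..<j} P" and \<tau>: "\<tau> permutes {1..<j}"
  shows "latin_square_on j P (permuted_addition_table j h \<tau>)"
  unfolding latin_square_on_def
proof (intro conjI allI impI ballI)
  let ?i = "inv_into {..<j} h"
  have i: "bij_betw ?i P {..<j}" using h by (rule bij_betw_inv_into)
  fix c
  have "bij_betw (h \<circ> ((\<lambda>i. (i + \<tau> c) mod j) \<circ> ?i)) P P"
    using i bij_betw_add_mod[OF j] h by (blast intro: bij_betw_trans)
  then show "bij_betw (permuted_addition_table j h \<tau> c) P P"
    by (simp add: permuted_addition_table_def[abs_def] o_def)
next
  let ?i = "inv_into {..<j} h"
  fix A
  have "\<tau> permutes {..<j}" using \<tau> by (rule permutes_subset) auto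
  then have "bij_betw \<tau> {..<j} {..<j}" by (rule permutes_imp_bij)
  then have "bij_betw (h \<circ> ((\<lambda>i. (i + ?i A) mod j) \<circ> \<tau>)) {..<j} P"
    using bij_betw_add_mod[OF j] h by (blast intro: bij_betw_trans)
  then show "bij_betw (\<lambda>c. permuted_addition_table j h \<tau> c A) {..<j} P"
    by (simp add: permuted_addition_table_def[abs_def] o_def add.commute)
qed

lemma permuted_addition_table_0:
  assumes h: "bij_betw h {..<j} P" and \<tau>: "\<tau> permutes {1..<j}" and A: "A \<in> P"
  shows "permuted_addition_table j h \<tau> 0 A = A"
proof -
  have "\<tau> 0 = 0" using \<tau> by (rule permutes_not_in) simp
  moreover have "inv_into {..<j} h A \<in> {..<j}"
    using h A by (auto simp: bij_betw_def intro: inv_into_into)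
  moreover have "h (inv_into {..<j} h A) = A"
    using h A by (simp add: bij_betw_def f_inv_into_f)
  ultimately show ?thesis by (simp add: permuted_addition_table_def)
qed

text \<open>The entry of row \<open>c\<close> in the column of \<open>h 0\<close> is \<open>h (\<tau> c)\<close>, so that one column already
  determines \<open>\<tau>\<close>.\<close>

lemma permuted_addition_table_eqD:
  assumes j: "j > 0" and h: "bij_betw h {..<j} P"
    and \<tau>: "\<tau> permutes {1..<j}" and \<tau>': "\<tau>' permutes {1..<j}"
    and eq: "\<And>c A. c < j \<Longrightarrow> A \<in> P \<Longrightarrow>
      permuted_addition_table j h \<tau> c A = permuted_addition_table j h \<tau>' c A"
  shows "\<tau> = \<tau>'"
proof
  fix c
  have inj: "inj_on h {..<j}" and h0: "h 0 \<in> P" using h j by (auto simp: bij_betw_def)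
  have i0: "inv_into {..<j} h (h 0) = 0" using inj j by (simp add: inv_into_f_f)
  show "\<tau> c = \<tau>' c"
  proof (cases "c < j")
    case True
    have "\<tau> permutes {..<j}" "\<tau>' permutes {..<j}"
      using \<tau> \<tau>' by (auto intro: permutes_subset)
    then have lt: "\<tau> c < j" "\<tau>' c < j"
      using True permutes_in_image by fastforce+
    have "h (\<tau> c) = h (\<tau>' c)"
      using eq[OF True h0] lt by (simp add: permuted_addition_table_def i0)
    then show ?thesis using inj lt by (auto dest: inj_onD)
  next
    case False
    then show ?thesis using \<tau> \<tau>' by (simp add: permutes_not_in)
  qed
qed

section \<open>Gluing translates\<close>

definition glue :: "nat \<Rightarrow> nat \<Rightarrow> (nat \<Rightarrow> nat set) \<Rightarrow> nat set" where
  "glue M j F = (\<Union>c<j. (\<lambda>a. c * M + a) ` F c)"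

definition slice :: "nat \<Rightarrow> nat \<Rightarrow> nat set \<Rightarrow> nat set" where
  "slice M c B = {x \<in> {1..M}. c * M + x \<in> B}"

lemma mult_add_eqD:
  fixes c d M x y :: nat
  assumes "c * M + x = d * M + y" "x \<in> {1..M}" "y \<in> {1..M}"
  shows "c = d" "x = y"
proof -
  \<comment> \<open>The residues lie in \<open>1..M\<close> instead of \<open>0..<M\<close>, so division with remainder applies to the
    predecessors.\<close>
  have div: "(c * M + z - 1) div M = c" if "z \<in> {1..M}" for c z
    using that by (intro div_nat_eqI) (auto simp: mult.commute)
  show "c = d" using div[OF assms(2), of c] div[OF assms(3), of d] assms(1) by simp
  then show "x = y" using assms by simp
qed

lemma slice_glue:
  assumes "\<And>c. c < j \<Longrightarrow> F c \<subseteq> {1..M}" and "c < j"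
  shows "slice M c (glue M j F) = F c"
proof
  show "slice M c (glue M j F) \<subseteq> F c"
  proof
    fix x assume "x \<in> slice M c (glue M j F)"
    then obtain d y where x: "x \<in> {1..M}" and d: "d < j" "y \<in> F d" "c * M + x = d * M + y"
      by (auto simp: slice_def glue_def)
    moreover have "y \<in> {1..M}" using assms(1) d by blast
    ultimately show "x \<in> F c" using mult_add_eqD[of c M x d y] by simp
  qed
  show "F c \<subseteq> slice M c (glue M j F)"
    using assms(1)[OF assms(2)] assms(2) by (auto simp: slice_def glue_def)
qed

lemma sum_glue:
  fixes g :: "nat \<Rightarrow> nat"
  assumes F: "\<And>c. c < j \<Longrightarrow> F c \<subseteq> {1..M}"
  shows "sum g (glue M j F) = (\<Sum>c<j. \<Sum>a\<in>F c. g (c * M + a))"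
proof -
  have "finite (F c)" if "c < j" for c using F[OF that] finite_subset by blast
  moreover have "(\<lambda>a. c * M + a) ` F c \<inter> (\<lambda>a. d * M + a) ` F d = {}"
    if "c < j" "d < j" "c \<noteq> d" for c d
  proof -
    have "c * M + a \<noteq> d * M + b" if "a \<in> F c" "b \<in> F d" for a b
      using mult_add_eqD(1)[of c M a d b] F \<open>c < j\<close> \<open>d < j\<close> \<open>c \<noteq> d\<close> that by blast
    then show ?thesis by blast
  qed
  ultimately have "sum g (glue M j F) = (\<Sum>c<j. sum g ((\<lambda>a. c * M + a) ` F c))"
    unfolding glue_def by (intro sum.UNION_disjoint) auto
  also have "\<dots> = (\<Sum>c<j. \<Sum>a\<in>F c. g (c * M + a))"
    by (simp add: sum.reindex o_def)
  finally show ?thesis .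
qed

lemma card_glue:
  assumes "\<And>c. c < j \<Longrightarrow> F c \<subseteq> {1..M}"
  shows "card (glue M j F) = (\<Sum>c<j. card (F c))"
  unfolding card_eq_sum using assms by (rule sum_glue)

definition glued_partition ::
  "nat \<Rightarrow> nat \<Rightarrow> (nat \<Rightarrow> nat set \<Rightarrow> nat set) \<Rightarrow> nat set set \<Rightarrow> nat set set" where
  "glued_partition M j L P = (\<lambda>A. glue M j (\<lambda>c. L c A)) ` P"

lemma latin_square_entry:
  assumes "latin_square_on j P L" "c < j" "A \<in> P"
  shows "L c A \<in> P"
proof -
  have "bij_betw (L c) P P" using assms by (simp add: latin_square_on_def)
  then show ?thesis using assms(3) by (rule bij_betwE[rule_format])
qed

lemma latin_square_entry_subset:
  assumes "latin_square_on j P L" "\<Union>P = X" "c < j" "A \<in> P"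
  shows "L c A \<subseteq> X"
  using latin_square_entry[OF assms(1,3,4)] assms(2) by blast

lemma partition_on_glued_partition:
  assumes P: "partition_on {1..M} P" and L: "latin_square_on j P L" and j: "j > 0"
  shows "partition_on {1..j * M} (glued_partition M j L P)"
proof (rule partition_onI)
  have U: "\<Union>P = {1..M}" using P by (simp add: partition_on_def)
  note sub = latin_square_entry_subset[OF L U]
  have "p \<noteq> {}" if p: "p \<in> glued_partition M j L P" for p
  proof -
    obtain A where A: "A \<in> P" "p = glue M j (\<lambda>c. L c A)"
      using p by (auto simp: glued_partition_def)
    have "L 0 A \<noteq> {}"
      using latin_square_entry[OF L j A(1)] P by (auto simp: partition_on_def)
    then show ?thesis using A j by (auto simp: glue_def)
  qed
  then show "{} \<notin> glued_partition M j L P" by blast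
  show "\<Union>(glued_partition M j L P) = {1..j * M}"
  proof
    show "\<Union>(glued_partition M j L P) \<subseteq> {1..j * M}"
    proof
      fix x assume "x \<in> \<Union>(glued_partition M j L P)"
      then obtain A c a where A: "A \<in> P" "c < j" "a \<in> L c A" "x = c * M + a"
        by (auto simp: glued_partition_def glue_def)
      then have a: "a \<in> {1..M}" using sub by blast
      have "Suc c * M \<le> j * M" using A by (intro mult_right_mono) auto
      then show "x \<in> {1..j * M}" using a A by auto
    qed
    show "{1..j * M} \<subseteq> \<Union>(glued_partition M j L P)"
    proof
      fix x assume x: "x \<in> {1..j * M}"
      then have M: "M > 0" by (cases M) auto
      define c where "c = (x - 1) div M"
      define a where "a = Suc ((x - 1) mod M)"
      have "c < j" unfolding c_def using x by (intro less_mult_imp_div_less) auto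
      have xa: "x = c * M + a" unfolding c_def a_def using x by simp
      have "a \<in> {1..M}" unfolding a_def using M by (simp add: Suc_leI)
      then obtain B where B: "B \<in> P" "a \<in> B" using U by blast
      have "L c ` P = P" using L \<open>c < j\<close> by (simp add: latin_square_on_def bij_betw_def)
      then have "B \<in> L c ` P" using B(1) by simp
      then obtain A where "A \<in> P" "L c A = B" by blast
      then have "x \<in> glue M j (\<lambda>c. L c A)" using B(2) \<open>c < j\<close> xa unfolding glue_def by blast
      then show "x \<in> \<Union>(glued_partition M j L P)"
        using \<open>A \<in> P\<close> unfolding glued_partition_def by blast
    qed
  qed
  show "disjnt p q" if pq: "p \<in> glued_partition M j L P" "q \<in> glued_partition M j L P" "p \<noteq> q"
    for p q
  proof -
    obtain A B where A: "A \<in> P" "p = glue M j (\<lambda>c. L c A)"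
      and B: "B \<in> P" "q = glue M j (\<lambda>c. L c B)" and "A \<noteq> B"
      using pq by (auto simp: glued_partition_def)
    have False if x: "x \<in> p" "x \<in> q" for x
    proof -
      obtain c a where c: "c < j" "a \<in> L c A" "x = c * M + a"
        using x A by (auto simp: glue_def)
      obtain d b where d: "d < j" "b \<in> L d B" "x = d * M + b"
        using x B by (auto simp: glue_def)
      have "a \<in> {1..M}" "b \<in> {1..M}" using sub c d A B by blast+
      then have "c = d" "a = b" using mult_add_eqD[of c M a d b] c d by simp_all
      then have "L c A \<inter> L c B \<noteq> {}" using c d by blast
      moreover have "L c A \<in> P" "L c B \<in> P"
        using latin_square_entry[OF L \<open>c < j\<close>] A B by blast+
      ultimately have "L c A = L c B"
        using P by (auto simp: partition_on_def disjoint_def)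
      moreover have "inj_on (L c) P" using L \<open>c < j\<close> by (auto simp: latin_square_on_def bij_betw_def)
      ultimately show False using A B \<open>A \<noteq> B\<close> by (auto dest: inj_onD)
    qed
    then show ?thesis by (auto simp: disjnt_def)
  qed
qed

text \<open>The slices of a glued block are the sets from which it was glued. Since row \<open>0\<close> is the
  identity, slice \<open>0\<close> of a block is its index \<open>A\<close>, which identifies the blocks of the two
  partitions with each other before their other slices are compared.\<close>

lemma glued_partition_eqD:
  assumes P: "\<Union>P = {1..M}" "latin_square_on j P L" "\<And>A. A \<in> P \<Longrightarrow> L 0 A = A"
    and Q: "\<Union>Q = {1..M}" "latin_square_on j Q K" "\<And>A. A \<in> Q \<Longrightarrow> K 0 A = A"
    and j: "j > 0" and eq: "glued_partition M j L P = glued_partition M j K Q"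
  shows "P = Q" and "\<And>c A. c < j \<Longrightarrow> A \<in> P \<Longrightarrow> L c A = K c A"
proof -
  have sP: "slice M c (glue M j (\<lambda>c. L c A)) = L c A" if "c < j" "A \<in> P" for c A
    using latin_square_entry_subset[OF P(2,1)] that by (intro slice_glue) auto
  have sQ: "slice M c (glue M j (\<lambda>c. K c A)) = K c A" if "c < j" "A \<in> Q" for c A
    using latin_square_entry_subset[OF Q(2,1)] that by (intro slice_glue) auto
  have "slice M 0 ` glued_partition M j L P = P"
    using sP[OF j] P(3) by (simp add: glued_partition_def image_image)
  moreover have "slice M 0 ` glued_partition M j K Q = Q"
    using sQ[OF j] Q(3) by (simp add: glued_partition_def image_image)
  ultimately show PQ: "P = Q" using eq by simp
  fix c A assume c: "c < j" and A: "A \<in> P"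
  have "glue M j (\<lambda>c. L c A) \<in> glued_partition M j K Q"
    unfolding eq[symmetric] using A by (simp add: glued_partition_def)
  then obtain B where B: "B \<in> Q" "glue M j (\<lambda>c. L c A) = glue M j (\<lambda>c. K c B)"
    by (auto simp: glued_partition_def)
  have "A = B" using sP[OF j A] sQ[OF j B(1)] P(3)[OF A] Q(3)[OF B(1)] B(2) by simp
  then show "L c A = K c A" using sP[OF c A] sQ[OF c B(1)] B(2) by simp
qed

section \<open>Power sums of glued blocks\<close>

text \<open>This is where the degree goes up by one. In the binomial expansion for \<open>r = k + 1\<close>, the
  power sum of degree \<open>k + 1\<close>, which may vary from block to block of \<open>P\<close>, has coefficient \<open>1\<close>
  whatever the translate, so that its total over a column of the Latin square is its total
  over \<open>P\<close>.\<close>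

lemma power_sum_glue_eq:
  assumes P: "\<Union>P = {1..M}" and L: "latin_square_on j P L"
    and eq: "\<And>l A B. l \<le> k \<Longrightarrow> A \<in> P \<Longrightarrow> B \<in> P \<Longrightarrow> (\<Sum>a\<in>A. a ^ l) = (\<Sum>b\<in>B. b ^ l)"
    and r: "r \<le> Suc k" and A: "A \<in> P" and B: "B \<in> P"
  shows "(\<Sum>x\<in>glue M j (\<lambda>c. L c A). x ^ r) = (\<Sum>x\<in>glue M j (\<lambda>c. L c B). x ^ r)"
proof -
  define p :: "nat \<Rightarrow> nat set \<Rightarrow> nat" where "p l X = (\<Sum>a\<in>X. a ^ l)" for l X
  have expand: "(\<Sum>x\<in>glue M j (\<lambda>c. L c X). x ^ r) =
      (\<Sum>l\<le>r. \<Sum>c<j. (r choose l) * (c * M) ^ (r - l) * p l (L c X))" if X: "X \<in> P" for X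
  proof -
    have "(\<Sum>x\<in>glue M j (\<lambda>c. L c X). x ^ r) = (\<Sum>c<j. \<Sum>a\<in>L c X. (c * M + a) ^ r)"
      using latin_square_entry_subset[OF L P] X by (intro sum_glue) auto
    also have "\<dots> = (\<Sum>c<j. \<Sum>a\<in>L c X. \<Sum>l\<le>r. (r choose l) * (c * M) ^ (r - l) * a ^ l)"
      by (subst add.commute, subst binomial_ring) (simp add: mult_ac)
    also have "\<dots> = (\<Sum>c<j. \<Sum>l\<le>r. (r choose l) * (c * M) ^ (r - l) * p l (L c X))"
      unfolding p_def sum_distrib_left by (intro sum.cong refl sum.swap)
    also have "\<dots> = (\<Sum>l\<le>r. \<Sum>c<j. (r choose l) * (c * M) ^ (r - l) * p l (L c X))"
      by (rule sum.swap)
    finally show ?thesis .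
  qed
  have term_eq: "(\<Sum>c<j. (r choose l) * (c * M) ^ (r - l) * p l (L c A)) =
      (\<Sum>c<j. (r choose l) * (c * M) ^ (r - l) * p l (L c B))" if l: "l \<le> r" for l
  proof (cases "l = r")
    case True
    have "(\<Sum>c<j. p r (L c X)) = (\<Sum>Y\<in>P. p r Y)" if "X \<in> P" for X
      using L that by (intro sum.reindex_bij_betw) (auto simp: latin_square_on_def)
    then show ?thesis using True A B by simp
  next
    case False
    then have "l \<le> k" using l r by simp
    then have "p l (L c A) = p l (L c B)" if "c < j" for c
      unfolding p_def using latin_square_entry[OF L that] A B by (intro eq) auto
    then show ?thesis by simp
  qed
  show ?thesis unfolding expand[OF A] expand[OF B] by (rule sum.cong[OF refl]) (simp add: term_eq)
qed

lemma glued_partition_is_separation: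
  assumes P: "P \<in> equal_power_sum_separations M j s k"
    and L: "latin_square_on j P L" and j: "j > 0"
    and id0: "\<And>A. A \<in> P \<Longrightarrow> L 0 A = A"
  shows "glued_partition M j L P \<in> equal_power_sum_separations (j * M) j (j * s) (Suc k)"
proof -
  have part: "partition_on {1..M} P" and cP: "card P = j"
    and s: "\<And>A. A \<in> P \<Longrightarrow> card A = s"
    and sums: "\<And>r A B. r \<in> {1..k} \<Longrightarrow> A \<in> P \<Longrightarrow> B \<in> P \<Longrightarrow> (\<Sum>a\<in>A. a ^ r) = (\<Sum>b\<in>B. b ^ r)"
    using P unfolding equal_power_sum_separations_def by blast+
  have U: "\<Union>P = {1..M}" using part by (simp add: partition_on_def)
  note sub = latin_square_entry_subset[OF L U]
  \<comment> \<open>The binomial expansion also needs degree \<open>0\<close>, where equality means equal block sizes.\<close>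
  have sums0: "(\<Sum>a\<in>A. a ^ l) = (\<Sum>b\<in>B. b ^ l)" if "l \<le> k" "A \<in> P" "B \<in> P" for l A B
  proof (cases "l = 0")
    case True
    then show ?thesis using that s by simp
  next
    case False
    then show ?thesis using that by (intro sums) auto
  qed
  have "inj_on (\<lambda>A. glue M j (\<lambda>c. L c A)) P"
  proof (rule inj_on_inverseI[where g = "slice M 0"])
    fix A assume "A \<in> P"
    then show "slice M 0 (glue M j (\<lambda>c. L c A)) = A"
      using slice_glue[of j "\<lambda>c. L c A" M 0] sub j id0 by simp
  qed
  then have "card (glued_partition M j L P) = j"
    using cP by (simp add: glued_partition_def card_image)
  moreover have "card B = j * s" if B: "B \<in> glued_partition M j L P" for B
  proof -
    obtain A where A: "A \<in> P" "B = glue M j (\<lambda>c. L c A)"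
      using B by (auto simp: glued_partition_def)
    have "card B = (\<Sum>c<j. card (L c A))"
      unfolding A(2) using sub A(1) by (intro card_glue) auto
    also have "\<dots> = (\<Sum>c<j. s)"
      using latin_square_entry[OF L] s A(1) by (intro sum.cong) auto
    finally show ?thesis by simp
  qed
  moreover have "(\<Sum>a\<in>A. a ^ r) = (\<Sum>b\<in>B. b ^ r)"
    if r: "r \<in> {1..Suc k}"
      and AB: "A \<in> glued_partition M j L P" "B \<in> glued_partition M j L P" for r A B
  proof -
    obtain X Y where "X \<in> P" "A = glue M j (\<lambda>c. L c X)" "Y \<in> P" "B = glue M j (\<lambda>c. L c Y)"
      using AB by (auto simp: glued_partition_def)
    then show ?thesis using r power_sum_glue_eq[OF U L sums0, of k r X Y] by simp
  qed
  ultimately show ?thesis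
    using partition_on_glued_partition[OF part L j]
    unfolding equal_power_sum_separations_def by blast
qed

section \<open>Counting separations\<close>

lemma finite_equal_power_sum_separations: "finite (equal_power_sum_separations N j s k)"
proof (rule finite_subset)
  show "equal_power_sum_separations N j s k \<subseteq> Pow (Pow {1..N})"
    by (auto simp: equal_power_sum_separations_def partition_on_def)
qed simp

lemma card_separations_step:
  assumes j: "j > 0"
  shows "fact (j - 1) * card (equal_power_sum_separations M j s k)
    \<le> card (equal_power_sum_separations (j * M) j (j * s) (Suc k))"
proof -
  let ?S = "equal_power_sum_separations M j s k"
  let ?T = "{\<tau>. \<tau> permutes {1..<j}}"
  \<comment> \<open>Each separation is given one labelling of its blocks. It is a function of the separation, so
    that equal separations yield the same addition table.\<close>
  have "\<exists>h. bij_betw h {..<j} P" if "P \<in> ?S" for P :: "nat set set"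
  proof -
    have "card P = j" using that by (simp add: equal_power_sum_separations_def)
    moreover have "finite P" using calculation j by (auto intro: card_ge_0_finite)
    ultimately show ?thesis
      using ex_bij_betw_nat_finite[of P] by (simp add: atLeast0LessThan)
  qed
  then obtain h where h: "\<And>P. P \<in> ?S \<Longrightarrow> bij_betw (h P) {..<j} P" by metis
  let ?L = "\<lambda>P \<tau>. permuted_addition_table j (h P) \<tau>"
  let ?f = "\<lambda>(P, \<tau>). glued_partition M j (?L P \<tau>) P"
  have L: "latin_square_on j P (?L P \<tau>)" if "P \<in> ?S" "\<tau> \<in> ?T" for P \<tau>
    using that h j by (intro latin_square_permuted_addition_table) auto
  have L0: "?L P \<tau> 0 A = A" if "P \<in> ?S" "\<tau> \<in> ?T" "A \<in> P" for P \<tau> A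
    using that h by (intro permuted_addition_table_0) auto
  have U: "\<Union>P = {1..M}" if "P \<in> ?S" for P
    using that by (simp add: equal_power_sum_separations_def partition_on_def)
  have "inj_on ?f (?S \<times> ?T)"
  proof (rule inj_onI)
    fix u v assume uv: "u \<in> ?S \<times> ?T" "v \<in> ?S \<times> ?T" "?f u = ?f v"
    obtain P \<tau> Q \<tau>' where eqs: "u = (P, \<tau>)" "v = (Q, \<tau>')" by (cases u, cases v) auto
    have P: "P \<in> ?S" "\<tau> \<in> ?T" and Q: "Q \<in> ?S" "\<tau>' \<in> ?T" using uv eqs by auto
    have g: "glued_partition M j (?L P \<tau>) P = glued_partition M j (?L Q \<tau>') Q"
      using uv(3) eqs by simp
    note D = glued_partition_eqD[OF U[OF P(1)] L[OF P] L0[OF P] U[OF Q(1)] L[OF Q] L0[OF Q] j g]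
    have "P = Q" by (rule D(1))
    then have "\<tau> = \<tau>'"
      using D(2) P Q by (intro permuted_addition_table_eqD[OF j h[OF P(1)]]) auto
    then show "u = v" using eqs \<open>P = Q\<close> by simp
  qed
  moreover have "?f ` (?S \<times> ?T) \<subseteq> equal_power_sum_separations (j * M) j (j * s) (Suc k)"
    using glued_partition_is_separation L L0 j by auto
  ultimately have "card (?S \<times> ?T) \<le> card (equal_power_sum_separations (j * M) j (j * s) (Suc k))"
    using finite_equal_power_sum_separations by (rule card_inj_on_le)
  moreover have "card ?T = fact (j - 1)" by (rule card_permutations) auto
  ultimately show ?thesis by (simp add: card_cartesian_product mult.commute)
qed

text \<open>The pairs \<open>{x, N + 1 - x}\<close> are ordered by their smaller element, and block \<open>i\<close> takes the
  \<open>i\<close>-th run of \<open>m\<close> consecutive pairs. As the blocks are the fibres of a map onto \<open>{..<j}\<close>, they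
  form a partition.\<close>

lemma equal_sum_separation_exists:
  fixes m j :: nat
  assumes m: "m > 0"
  shows "equal_power_sum_separations (2 * m * j) j (2 * m) 1 \<noteq> {}"
proof -
  define N where "N = 2 * m * j"
  define f where "f x = (min x (Suc N - x) - 1) div m" for x
  define A where "A i = {x \<in> {1..N}. f x = i}" for i
  define C where "C i = {i * m <.. Suc i * m}" for i
  define R where "R = (\<lambda>x. Suc N - x)"
  have C_le: "2 * x \<le> N" "x \<ge> 1" if "x \<in> C i" "i < j" for x i
  proof -
    have "Suc i * m \<le> j * m" using that by (intro mult_right_mono) auto
    then have "x \<le> m * j" using that(1) by (simp add: C_def mult.commute[of j m])
    then show "2 * x \<le> N" by (simp add: N_def)
    show "x \<ge> 1" using that(1) by (simp add: C_def)
  qed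
  have div_iff: "(x - 1) div m = i \<longleftrightarrow> x \<in> C i" if "x \<ge> 1" for x i
  proof
    assume "(x - 1) div m = i"
    then have "i * m \<le> x - 1" "x - 1 < Suc i * m"
      using m div_less_iff_less_mult[of m "x - 1" "Suc i"] by auto
    then show "x \<in> C i" using that by (auto simp: C_def)
  next
    assume "x \<in> C i"
    then have "m * i \<le> x - 1" "x - 1 < m * Suc i" using that by (auto simp: C_def mult.commute)
    then show "(x - 1) div m = i" by (rule div_nat_eqI)
  qed
  have A_eq: "A i = C i \<union> R ` C i" if i: "i < j" for i
  proof
    show "A i \<subseteq> C i \<union> R ` C i"
    proof
      fix x assume "x \<in> A i"
      then have x: "x \<in> {1..N}" "f x = i" by (auto simp: A_def)
      then have "min x (Suc N - x) \<in> C i"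
        using div_iff[of "min x (Suc N - x)" i] by (auto simp: f_def)
      moreover have "x = R (Suc N - x)" using x by (simp add: R_def)
      ultimately show "x \<in> C i \<union> R ` C i" by (auto simp: min_def split: if_splits)
    qed
    show "C i \<union> R ` C i \<subseteq> A i"
    proof
      fix x assume "x \<in> C i \<union> R ` C i"
      then obtain y where y: "y \<in> C i" "x = y \<or> x = R y" by blast
      then have "min x (Suc N - x) = y" "x \<in> {1..N}"
        using C_le[OF y(1) i] by (auto simp: R_def)
      then show "x \<in> A i" using div_iff[of y i] y(1) C_le[OF y(1) i] by (simp add: A_def f_def)
    qed
  qed
  have f_less: "f x < j" if "x \<in> {1..N}" for x
    unfolding f_def using that by (intro less_mult_imp_div_less) (auto simp: N_def mult_ac)
  have sum_A: "(\<Sum>x\<in>A i. g x) = (\<Sum>x\<in>C i. g x + g (Suc N - x))" if i: "i < j"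
    for i and g :: "nat \<Rightarrow> nat"
  proof -
    have "C i \<inter> R ` C i = {}"
    proof -
      have "x \<noteq> R y" if "x \<in> C i" "y \<in> C i" for x y
        using C_le[OF that(1) i] C_le[OF that(2) i] by (auto simp: R_def)
      then show ?thesis by blast
    qed
    moreover have "inj_on R (C i)"
    proof (rule inj_onI)
      fix x y assume "x \<in> C i" "y \<in> C i" "R x = R y"
      then show "x = y" using C_le[of x i] C_le[of y i] i by (auto simp: R_def)
    qed
    moreover have "finite (C i)" by (simp add: C_def)
    ultimately show ?thesis
      by (simp add: A_eq[OF i] sum.union_disjoint sum.reindex sum.distrib R_def)
  qed
  have card_C: "card (C i) = m" for i by (simp add: C_def)
  have card_A: "card (A i) = 2 * m" if "i < j" for i
    using sum_A[OF that, of "\<lambda>_. 1"] card_C by simp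
  have total_A: "(\<Sum>x\<in>A i. x) = m * Suc N" if i: "i < j" for i
  proof -
    have "(\<Sum>x\<in>A i. x) = (\<Sum>x\<in>C i. x + (Suc N - x))" by (rule sum_A[OF i])
    also have "\<dots> = (\<Sum>x\<in>C i. Suc N)"
    proof (rule sum.cong[OF refl])
      fix x assume "x \<in> C i"
      then show "x + (Suc N - x) = Suc N" using C_le[of x i] i by simp
    qed
    finally show ?thesis by (simp add: card_C)
  qed
  have ne: "A i \<noteq> {}" if "i < j" for i using card_A[OF that] m by auto
  have "inj_on A {..<j}"
  proof (rule inj_onI)
    fix i i' assume "i \<in> {..<j}" "i' \<in> {..<j}" and eq: "A i = A i'"
    then obtain x where "x \<in> A i" using ne by blast
    then show "i = i'" using eq by (auto simp: A_def)
  qed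
  then have "card (A ` {..<j}) = j" by (simp add: card_image)
  moreover have "partition_on {1..N} (A ` {..<j})"
  proof (rule partition_onI)
    show "\<Union>(A ` {..<j}) = {1..N}" using f_less by (auto simp: A_def)
  qed (use ne in \<open>auto simp: A_def disjnt_def\<close>)
  ultimately have "A ` {..<j} \<in> equal_power_sum_separations N j (2 * m) 1"
    using card_A total_A by (auto simp: equal_power_sum_separations_def)
  then show ?thesis unfolding N_def by blast
qed

theorem theorem7:
  fixes m j k N :: nat
  assumes "m \<ge> 1" and "j \<ge> 2" and "k \<ge> 1" and "N = 2 * m * j ^ k"
  shows "card (equal_power_sum_separations N j (2 * m * j ^ (k - 1)) k) \<ge> fact (j - 1) ^ (k - 1)"
proof -
  have "fact (j - 1) ^ n \<le> card (equal_power_sum_separations (2 * m * j ^ Suc n) j (2 * m * j ^ n) (Suc n))"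
    for n
  proof (induction n)
    case 0
    have "card (equal_power_sum_separations (2 * m * j) j (2 * m) 1) > 0"
      using equal_sum_separation_exists[of m j] finite_equal_power_sum_separations assms(1)
      by (simp add: card_gt_0_iff)
    then show ?case by simp
  next
    case (Suc n)
    have "fact (j - 1) ^ Suc n \<le> fact (j - 1) *
        card (equal_power_sum_separations (2 * m * j ^ Suc n) j (2 * m * j ^ n) (Suc n))"
      by (subst power_Suc) (rule mult_le_mono2[OF Suc.IH])
    also have "\<dots> \<le> card (equal_power_sum_separations (j * (2 * m * j ^ Suc n)) j
        (j * (2 * m * j ^ n)) (Suc (Suc n)))"
      using assms(2) by (intro card_separations_step) simp
    finally show ?case by (simp add: mult_ac)
  qed
  from this[of "k - 1"] show ?thesis using assms by simp
qed

end
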